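(* For every rational number $k$, $$(30k^2-2k-31)^2+(-31k^2-60k+1)^2+(-k^2-62k-30)^2+(36^2+7^2+17^2)(k^2+k+1)^2=(3^2+4^2+19^2+27^2+34^2+35^2)(k^2+k+1)^2 .$$
   Context: This is a one-parameter family of solutions of $a^2+b^2+c^2+d^2+e^2+f^2=p^2+q^2+r^2+s^2+t^2+u^2$; here $k$ is a free parameter. *)

theory Defs
  imports Complex_Main
begin

end

theory Submission
  imports Defs
begin

text \<open>
  The third bracket on the left is the sum of the first two, and
  \<open>x\<^sup>2 + y\<^sup>2 + (x - y)\<^sup>2 = 2 (x\<^sup>2 - x y + y\<^sup>2)\<close> is twice the norm of \<open>x + y \<omega>\<close>, where \<open>\<omega>\<close> is a
  primitive cube root of unity. So the claim is about the norm of
  \<open>(30 k\<^sup>2 - 2 k - 31) + (31 k\<^sup>2 + 60 k - 1) \<omega>\<close>, and this element factors as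
  \<open>(30 + 31 \<omega>) (k + 1 + \<omega>)\<^sup>2\<close>. The norm of \<open>k + 1 + \<omega>\<close> is \<open>k\<^sup>2 + k + 1\<close> and that of
  \<open>30 + 31 \<omega>\<close> is 931, so multiplicativity turns the three squares into
  \<open>2 * 931 * (k\<^sup>2 + k + 1)\<^sup>2\<close>. What remains is the numerical identity
  \<open>1862 + 36\<^sup>2 + 7\<^sup>2 + 17\<^sup>2 = 3\<^sup>2 + 4\<^sup>2 + 19\<^sup>2 + 27\<^sup>2 + 34\<^sup>2 + 35\<^sup>2\<close>.
\<close>

text \<open>The norm of \<open>x + y \<omega>\<close>, with \<open>\<omega>\<^sup>2 = - \<omega> - 1\<close>.\<close>
definition eisenstein_norm :: "'a::comm_ring_1 \<Rightarrow> 'a \<Rightarrow> 'a" where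
  "eisenstein_norm x y = x^2 - x * y + y^2"

text \<open>The arguments on the left are the coordinates of \<open>(x + y \<omega>) (u + v \<omega>)\<close>.\<close>
lemma eisenstein_norm_mult:
  "eisenstein_norm (x * u - y * v) (x * v + y * u - y * v)
     = eisenstein_norm x y * eisenstein_norm u v"
  by (simp add: eisenstein_norm_def power2_eq_square algebra_simps)

lemma sum_three_squares_eq_eisenstein_norm:
  fixes x y :: "'a::comm_ring_1"
  shows "x^2 + (- y)^2 + (x - y)^2 = 2 * eisenstein_norm x y"
  by (simp add: eisenstein_norm_def power2_eq_square algebra_simps)

theorem mainTheorem1:
  fixes k :: rat
  shows "(30 * k^2 - 2 * k - 31)^2 + (- 31 * k^2 - 60 * k + 1)^2 + (- (k^2) - 62 * k - 30)^2
           + (36^2 + 7^2 + 17^2) * (k^2 + k + 1)^2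
         = (3^2 + 4^2 + 19^2 + 27^2 + 34^2 + 35^2) * (k^2 + k + 1)^2"
proof -
  define x y where "x = 30 * k^2 - 2 * k - 31" and "y = 31 * k^2 + 60 * k - 1"
  \<comment> \<open>The coordinates of \<open>(k + 1 + \<omega>)\<^sup>2\<close>.\<close>
  define u v where "u = k^2 + 2 * k" and "v = 2 * k + 1"
  have "u = (k + 1) * (k + 1) - 1 * 1" "v = (k + 1) * 1 + 1 * (k + 1) - 1 * 1"
    by (simp_all add: u_def v_def power2_eq_square algebra_simps)
  then have "eisenstein_norm u v = eisenstein_norm (k + 1) 1 * eisenstein_norm (k + 1) 1"
    by (simp only: eisenstein_norm_mult)
  also have "eisenstein_norm (k + 1) 1 = k^2 + k + 1"
    by (simp add: eisenstein_norm_def power2_eq_square algebra_simps)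
  finally have uv: "eisenstein_norm u v = (k^2 + k + 1)^2"
    by (simp only: power2_eq_square)
  have "x = 30 * u - 31 * v" "y = 30 * v + 31 * u - 31 * v"
    by (simp_all add: x_def y_def u_def v_def algebra_simps)
  then have "eisenstein_norm x y = eisenstein_norm 30 31 * eisenstein_norm u v"
    by (simp only: eisenstein_norm_mult)
  also have "eisenstein_norm 30 31 = (931 :: rat)"
    by (simp add: eisenstein_norm_def)
  finally have xy: "eisenstein_norm x y = 931 * (k^2 + k + 1)^2"
    by (simp only: uv)
  have "- 31 * k^2 - 60 * k + 1 = - y" "- (k^2) - 62 * k - 30 = x - y"
    by (simp_all add: x_def y_def)
  then have "(30 * k^2 - 2 * k - 31)^2 + (- 31 * k^2 - 60 * k + 1)^2 + (- (k^2) - 62 * k - 30)^2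
      = x^2 + (- y)^2 + (x - y)^2"
    by (simp only: x_def)
  also have "\<dots> = 1862 * (k^2 + k + 1)^2"
    by (simp only: sum_three_squares_eq_eisenstein_norm xy)
  finally show ?thesis
    by simp
qed

end
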